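(* For $(p,q)\in\mathbf{N}$ and every $k\in\mathbb{N}_0$, $$\mu_k(\Lambda^*_{p,q})=\sum_{k_1+\cdots+k_7=k}\binom{k}{k_1,\ldots,k_7}3^{k_1}\,\mathbf{1}\left\{\begin{array}{l}pk-k_2-k_4+k_5+k_7\equiv 0 \bmod p\\ p(-k_2+k_3+k_5-k_6)=q(k_2+k_4-k_5-k_7)\end{array}\right\},$$ where $k_1,\ldots,k_7$ range over non-negative integers.
   Context: $\mathbb{N}_0=\{0,1,2,\ldots\}$ and $\mathbf{N}:=\{(p,q)\in\mathbb{N}_0^2 : p+q\ge 5,\ q\le p\}$. For such $(p,q)$, $\Lambda^*_{p,q}$ denotes the random eigenvalue of the dual infinite $(p,q)$-nanotube (the triangular lattice with a loop of weight $3$ at each vertex, rolled up along the chiral vector $(p,q)$), i.e. the real random variable with compactly supported distribution whose moments $\mu_k(\Lambda^*_{p,q})=\mathbb{E}(\Lambda^*_{p,q})^k$, $k\in\mathbb{N}_0$, are the (weighted) numbers of closed paths with $k$ steps from a vertex of this graph, given by $$\mu_k(\Lambda^*_{p,q})=\frac{1}{(2\pi)^3}\sum_{j\in\mathbb{Z}}\int_{-\pi}^{\pi}\int_{-\pi}^{\pi}\int_{-\pi}^{\pi}\left|e^{ix}+e^{iy}+e^{iz}\right|^{2k}e^{ij(p(x-z)+q(y-z))}\,dx\,dy\,dz .$$ For each fixed $k$ only finitely many terms of the sum are non-zero. Here $\binom{k}{k_1,\ldots,k_7}=\frac{k!}{k_1!\cdots k_7!}$, and $\mathbf{1}\{\cdot\}$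 is $1$ if both listed conditions hold and $0$ otherwise. *)

theory Defs
  imports "HOL-Probability.Probability" "HOL-Number_Theory.Cong"
begin

definition nanotube_index :: "(nat \<times> nat) set" where
  "nanotube_index = {(p, q). p + q \<ge> 5 \<and> q \<le> p}"

definition torus_integral :: "(real \<Rightarrow> real \<Rightarrow> real \<Rightarrow> complex) \<Rightarrow> complex" where
  "torus_integral f =
     integral {-pi..pi} (\<lambda>z. integral {-pi..pi} (\<lambda>y. integral {-pi..pi} (\<lambda>x. f x y z)))"

text \<open>
  All but finitely many terms of the sum over \<open>j\<close> vanish, so the unordered infinite sum is the
  intended finite one. The value is complex by type only: it is the natural number computed
  in \<open>dual_nanotube_moment_eq_walks\<close> below.
\<close>

definition dual_nanotube_moment :: "nat \<Rightarrow> nat \<Rightarrow> nat \<Rightarrow> complex" where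
  "dual_nanotube_moment p q k =
     1 / (2 * complex_of_real pi) ^ 3 *
     (\<Sum>\<^sub>\<infinity>j\<in>(UNIV :: int set). torus_integral (\<lambda>x y z.
        complex_of_real (norm (exp (\<i> * of_real x) + exp (\<i> * of_real y) + exp (\<i> * of_real z)) ^ (2 * k)) *
        exp (\<i> * of_int j * of_real (real p * (x - z) + real q * (y - z)))))"

text \<open>
  The random eigenvalue is determined by its moments only up to equality in distribution, so it is
  a predicate on random variables \<open>X\<close> over an arbitrary probability space \<open>M\<close>.
\<close>

definition dual_nanotube_eigenvalue :: "nat \<Rightarrow> nat \<Rightarrow> 'a measure \<Rightarrow> ('a \<Rightarrow> real) \<Rightarrow> bool" where
  "dual_nanotube_eigenvalue p q M X \<longleftrightarrow>
     prob_space M \<and> X \<in> borel_measurable M \<and>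
     (\<exists>K. compact K \<and> (AE \<omega> in M. X \<omega> \<in> K)) \<and>
     (\<forall>k. complex_of_real (\<integral>\<omega>. X \<omega> ^ k \<partial>M) = dual_nanotube_moment p q k)"


text \<open>
  A point \<open>(a, b)\<close> of the triangular lattice stands for \<open>a u + b v\<close>, where \<open>u\<close>
  and \<open>v\<close> are unit vectors at an angle of 60 degrees; the vertices of the tube are the cosets of the
  subgroup generated by the chiral vector \<open>(p, q)\<close>.
\<close>

definition tri_steps :: "(int \<times> int) set" where
  "tri_steps = {(1, 0), (-1, 0), (0, 1), (0, -1), (1, -1), (-1, 1)}"

definition tube_vertex :: "nat \<Rightarrow> nat \<Rightarrow> int \<Rightarrow> int \<Rightarrow> (int \<times> int) set" where
  "tube_vertex p q a b = range (\<lambda>j. (a + j * int p, b + j * int q))"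

definition tube_vertices :: "nat \<Rightarrow> nat \<Rightarrow> (int \<times> int) set set" where
  "tube_vertices p q = {tube_vertex p q a b | a b. True}"

definition tube_weight :: "(int \<times> int) set \<Rightarrow> (int \<times> int) set \<Rightarrow> nat" where
  "tube_weight u v =
     (if u = v then 3 else if \<exists>s\<in>u. \<exists>t\<in>v. t - s \<in> tri_steps then 1 else 0)"

fun tube_walks :: "nat \<Rightarrow> nat \<Rightarrow> nat \<Rightarrow> (int \<times> int) set \<Rightarrow> (int \<times> int) set \<Rightarrow> nat" where
  "tube_walks p q 0 u v = of_bool (u = v)"
| "tube_walks p q (Suc k) u v =
     (\<Sum>w | w \<in> tube_vertices p q \<and> tube_weight u w \<noteq> 0. tube_weight u w * tube_walks p q k w v)"


lemma mem_tube_vertex_iff: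
  "(c, d) \<in> tube_vertex p q a b \<longleftrightarrow> (\<exists>j. c = a + j * int p \<and> d = b + j * int q)"
  by (auto simp: tube_vertex_def)

lemma tube_vertex_self: "(a, b) \<in> tube_vertex p q a b"
  unfolding mem_tube_vertex_iff by (rule exI[of _ 0]) simp

lemma tube_vertex_shift:
  "tube_vertex p q (a + j * int p) (b + j * int q) = tube_vertex p q a b"
proof -
  have "(c, d) \<in> tube_vertex p q (a + j * int p) (b + j * int q) \<longleftrightarrow> (c, d) \<in> tube_vertex p q a b"
    for c d
  proof
    assume "(c, d) \<in> tube_vertex p q (a + j * int p) (b + j * int q)"
    then obtain i where "c = a + j * int p + i * int p" "d = b + j * int q + i * int q"
      unfolding mem_tube_vertex_iff by blast
    then have "c = a + (j + i) * int p \<and> d = b + (j + i) * int q"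
      by (simp add: distrib_right)
    then show "(c, d) \<in> tube_vertex p q a b"
      unfolding mem_tube_vertex_iff by blast
  next
    assume "(c, d) \<in> tube_vertex p q a b"
    then obtain i where "c = a + i * int p" "d = b + i * int q"
      unfolding mem_tube_vertex_iff by blast
    then have "c = a + j * int p + (i - j) * int p \<and> d = b + j * int q + (i - j) * int q"
      by (simp add: left_diff_distrib)
    then show "(c, d) \<in> tube_vertex p q (a + j * int p) (b + j * int q)"
      unfolding mem_tube_vertex_iff by blast
  qed
  then show ?thesis by auto
qed

lemma tube_vertex_eq_iff:
  "tube_vertex p q a b = tube_vertex p q c d \<longleftrightarrow> (\<exists>j. c = a + j * int p \<and> d = b + j * int q)"
  using mem_tube_vertex_iff tube_vertex_self tube_vertex_shift by metis

lemma tube_vertex_close: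
  assumes "(p, q) \<in> nanotube_index" "tube_vertex p q a b = tube_vertex p q c d"
    and "\<bar>(c + d) - (a + b)\<bar> < 5"
  shows "a = c \<and> b = d"
proof -
  obtain j where j: "c = a + j * int p" "d = b + j * int q"
    using assms(2) by (auto simp: tube_vertex_eq_iff)
  have lt: "\<bar>j * (int p + int q)\<bar> < 5" using assms(3) by (simp add: j algebra_simps)
  have ge: "5 \<le> int p + int q" using assms(1) by (auto simp: nanotube_index_def)
  have "\<bar>j\<bar> * 5 \<le> \<bar>j\<bar> * (int p + int q)" by (rule mult_left_mono[OF ge]) simp
  also have "\<dots> = \<bar>j * (int p + int q)\<bar>" using ge by (simp add: abs_mult)
  finally have "\<bar>j\<bar> * 5 < 5" using lt by linarith
  then have "j = 0" by simp
  then show ?thesis using j by simp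
qed

lemma tube_adjacent_iff:
  "(\<exists>s\<in>tube_vertex p q a b. \<exists>t\<in>tube_vertex p q c d. t - s \<in> tri_steps) \<longleftrightarrow>
   (\<exists>s\<in>tri_steps. tube_vertex p q c d = tube_vertex p q (a + fst s) (b + snd s))"
proof
  assume "\<exists>s\<in>tube_vertex p q a b. \<exists>t\<in>tube_vertex p q c d. t - s \<in> tri_steps"
  then obtain i j where
    ij: "(c + j * int p, d + j * int q) - (a + i * int p, b + i * int q) \<in> tri_steps"
    by (auto simp: tube_vertex_def)
  show "\<exists>s\<in>tri_steps. tube_vertex p q c d = tube_vertex p q (a + fst s) (b + snd s)"
    by (rule bexI[OF _ ij]) (auto simp: tube_vertex_eq_iff algebra_simps intro!: exI[of _ "j - i"])
next
  assume "\<exists>s\<in>tri_steps. tube_vertex p q c d = tube_vertex p q (a + fst s) (b + snd s)"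
  then obtain s where s: "s \<in> tri_steps"
    "tube_vertex p q c d = tube_vertex p q (a + fst s) (b + snd s)" by blast
  have "(a, b) \<in> tube_vertex p q a b" by (rule tube_vertex_self)
  moreover have "(a + fst s, b + snd s) \<in> tube_vertex p q (a + fst s) (b + snd s)"
    by (rule tube_vertex_self)
  moreover have "(a + fst s, b + snd s) - (a, b) = s" by (simp add: prod_eq_iff)
  ultimately show "\<exists>s\<in>tube_vertex p q a b. \<exists>t\<in>tube_vertex p q c d. t - s \<in> tri_steps"
    using s by metis
qed

lemma tube_walks_Suc:
  assumes pq: "(p, q) \<in> nanotube_index"
  shows "tube_walks p q (Suc k) (tube_vertex p q a b) v =
    3 * tube_walks p q k (tube_vertex p q a b) v +
    (\<Sum>s\<in>tri_steps. tube_walks p q k (tube_vertex p q (a + fst s) (b + snd s)) v)"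
proof -
  let ?u = "tube_vertex p q a b"
  let ?n = "\<lambda>s. tube_vertex p q (a + fst s) (b + snd s)"
  have fin: "finite tri_steps" by (simp add: tri_steps_def)
  have sm: "\<bar>fst s + snd s\<bar> \<le> 1" if "s \<in> tri_steps" for s
    using that by (auto simp: tri_steps_def)
  have inj: "inj_on ?n tri_steps"
  proof (rule inj_onI)
    fix s t assume st: "s \<in> tri_steps" "t \<in> tri_steps" "?n s = ?n t"
    then show "s = t"
      using tube_vertex_close[OF pq st(3)] sm[OF st(1)] sm[OF st(2)] by (auto simp: prod_eq_iff)
  qed
  have notin: "?u \<notin> ?n ` tri_steps"
  proof
    assume "?u \<in> ?n ` tri_steps"
    then obtain s where s: "s \<in> tri_steps" "?u = ?n s" by blast
    then have "fst s = 0 \<and> snd s = 0"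
      using tube_vertex_close[OF pq s(2)] sm[OF s(1)] by auto
    then show False using s(1) by (auto simp: tri_steps_def)
  qed
  have wt: "tube_weight ?u (tube_vertex p q c d) =
      (if ?u = tube_vertex p q c d then 3
       else if tube_vertex p q c d \<in> ?n ` tri_steps then 1 else 0)" for c d
    unfolding tube_weight_def tube_adjacent_iff by (auto simp: image_iff)
  have set: "{w. w \<in> tube_vertices p q \<and> tube_weight ?u w \<noteq> 0} = insert ?u (?n ` tri_steps)"
    (is "?A = ?B")
  proof (intro equalityI subsetI)
    fix w assume "w \<in> ?A"
    then show "w \<in> ?B" by (auto simp: tube_vertices_def wt split: if_splits)
  next
    fix w assume w: "w \<in> ?B"
    then obtain c d where cd: "w = tube_vertex p q c d" by auto
    then show "w \<in> ?A" using w wt[of c d] by (auto simp: tube_vertices_def)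
  qed
  have "tube_walks p q (Suc k) ?u v =
    tube_weight ?u ?u * tube_walks p q k ?u v +
    (\<Sum>w\<in>?n ` tri_steps. tube_weight ?u w * tube_walks p q k w v)"
    unfolding tube_walks.simps set using fin notin by (subst sum.insert) auto
  also have "(\<Sum>w\<in>?n ` tri_steps. tube_weight ?u w * tube_walks p q k w v) =
      (\<Sum>s\<in>tri_steps. tube_weight ?u (?n s) * tube_walks p q k (?n s) v)"
    by (subst sum.reindex[OF inj]) simp
  also have "\<dots> = (\<Sum>s\<in>tri_steps. tube_walks p q k (?n s) v)"
  proof (rule sum.cong[OF refl])
    fix s assume "s \<in> tri_steps"
    then have "?n s \<in> ?n ` tri_steps" by blast
    moreover from this notin have "?u \<noteq> ?n s" by metis
    ultimately show "tube_weight ?u (?n s) * tube_walks p q k (?n s) v = tube_walks p q k (?n s) v"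
      by (simp only: wt if_False if_True mult_1)
  qed
  also have "tube_weight ?u ?u = 3" by (simp add: tube_weight_def)
  finally show ?thesis .
qed


subsection \<open>The moments count closed walks\<close>

lemma norm_sum_cis_power2:
  "complex_of_real (norm (cis x + cis y + cis z) ^ 2) * cis (a * (x - z) + b * (y - z)) =
   3 * cis (a * (x - z) + b * (y - z)) +
   (\<Sum>s\<in>tri_steps. cis ((a + of_int (fst s)) * (x - z) + (b + of_int (snd s)) * (y - z)))"
proof -
  have eq: "complex_of_real (norm (cis x + cis y + cis z) ^ 2) =
      (cis x + cis y + cis z) * (cis (-x) + cis (-y) + cis (-z))"
    unfolding complex_norm_square by (simp add: cis_cnj)
  show ?thesis
    unfolding eq tri_steps_def by (simp add: algebra_simps cis_mult)
qed

lemma continuous_on_torus_inner: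
  fixes f :: "'b::topological_space \<Rightarrow> real \<Rightarrow> complex"
  assumes "continuous_on UNIV (\<lambda>(t, x). f t x)"
  shows "continuous_on UNIV (\<lambda>t. integral {-pi..pi} (f t))"
  using integral_continuous_on_param[of UNIV "-pi" pi f]
    continuous_on_subset[OF assms, of "UNIV \<times> cbox (-pi) pi"] by simp

lemma torus_integrands_integrable:
  fixes f :: "real \<Rightarrow> real \<Rightarrow> real \<Rightarrow> complex"
  assumes "continuous_on UNIV (\<lambda>(x, y, z). f x y z)"
  shows "f' = (\<lambda>x. f x y z) \<Longrightarrow> f' integrable_on {-pi..pi}"
    and "(\<lambda>y. integral {-pi..pi} (\<lambda>x. f x y z)) integrable_on {-pi..pi}"
    and "(\<lambda>z. integral {-pi..pi} (\<lambda>y. integral {-pi..pi} (\<lambda>x. f x y z))) integrable_on {-pi..pi}"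
proof -
  have 1: "continuous_on UNIV (\<lambda>((z, y), x). f x y z)"
    using continuous_on_compose2[OF assms, of UNIV "\<lambda>((z, y), x). (x, y, z)"]
    by (simp add: case_prod_unfold continuous_intros)
  have 2: "continuous_on UNIV (\<lambda>(z, y). integral {-pi..pi} (\<lambda>x. f x y z))"
    using continuous_on_torus_inner[of "\<lambda>(z, y) x. f x y z"] 1 by (simp add: case_prod_unfold)
  have 3: "continuous_on UNIV (\<lambda>z. integral {-pi..pi} (\<lambda>y. integral {-pi..pi} (\<lambda>x. f x y z)))"
    using continuous_on_torus_inner[OF 2] by simp
  show "f' integrable_on {-pi..pi}" if "f' = (\<lambda>x. f x y z)"
    unfolding that
    using continuous_on_compose2[OF assms, of "{-pi..pi}" "\<lambda>x. (x, y, z)"]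
    by (intro integrable_continuous_interval) (simp add: continuous_intros)
  show "(\<lambda>y. integral {-pi..pi} (\<lambda>x. f x y z)) integrable_on {-pi..pi}"
    using continuous_on_compose2[OF 2, of "{-pi..pi}" "\<lambda>y. (z, y)"]
    by (intro integrable_continuous_interval) (simp add: continuous_intros)
  show "(\<lambda>z. integral {-pi..pi} (\<lambda>y. integral {-pi..pi} (\<lambda>x. f x y z))) integrable_on {-pi..pi}"
    using continuous_on_subset[OF 3] by (intro integrable_continuous_interval) auto
qed

lemma torus_integral_add:
  assumes "continuous_on UNIV (\<lambda>(x, y, z). f x y z)" "continuous_on UNIV (\<lambda>(x, y, z). g x y z)"
  shows "torus_integral (\<lambda>x y z. f x y z + g x y z) = torus_integral f + torus_integral g"
  unfolding torus_integral_def
  by (simp add: integral_add torus_integrands_integrable(2,3)[OF assms(1)]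
      torus_integrands_integrable(2,3)[OF assms(2)]
      torus_integrands_integrable(1)[OF assms(1) refl] torus_integrands_integrable(1)[OF assms(2) refl])

lemma torus_integral_cmult: "torus_integral (\<lambda>x y z. c * f x y z) = c * torus_integral f"
  unfolding torus_integral_def by (simp add: integral_mult_right)

lemma torus_integral_sum:
  assumes "finite S" "\<And>s. s \<in> S \<Longrightarrow> continuous_on UNIV (\<lambda>(x, y, z). f s x y z)"
  shows "torus_integral (\<lambda>x y z. \<Sum>s\<in>S. f s x y z) = (\<Sum>s\<in>S. torus_integral (f s))"
  using assms
proof (induction S rule: finite_induct)
  case empty
  show ?case by (simp add: torus_integral_def)
next
  case (insert s S)
  have "continuous_on UNIV (\<lambda>(x, y, z). \<Sum>s\<in>S. f s x y z)"
    using insert.prems by (auto simp: case_prod_unfold intro!: continuous_on_sum)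
  then show ?case
    using insert by (simp add: torus_integral_add)
qed

lemma has_integral_cis_mult:
  "((\<lambda>x. cis (c * x)) has_integral (if c = 0 then 2 * of_real pi else of_real (2 * sin (c * pi) / c))) {-pi..pi}"
proof (cases "c = 0")
  case True
  then show ?thesis
    using has_integral_const_real[of "1::complex" "-pi" pi] by (simp add: scaleR_conv_of_real)
next
  case False
  have "((\<lambda>x. cis (c * x)) has_integral (cis (c * pi) / (\<i> * of_real c) - cis (c * (-pi)) / (\<i> * of_real c))) {-pi..pi}"
  proof (rule fundamental_theorem_of_calculus)
    fix x :: real
    have "((\<lambda>z. exp (\<i> * (of_real c * z)) / (\<i> * of_real c)) has_field_derivative
        exp (\<i> * (of_real c * of_real x))) (at (of_real x))"
      using False by (auto intro!: derivative_eq_intros simp: mult_ac)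
    from has_vector_derivative_real_field[OF this, of "{-pi..pi}"]
    show "((\<lambda>x. cis (c * x) / (\<i> * of_real c)) has_vector_derivative cis (c * x)) (at x within {-pi..pi})"
      by (simp add: cis_conv_exp)
  qed simp
  also have "cis (c * pi) / (\<i> * of_real c) - cis (c * (-pi)) / (\<i> * of_real c) = of_real (2 * sin (c * pi) / c)"
    using False by (simp add: complex_eq_iff cis.ctr Re_divide Im_divide power2_eq_square field_simps)
  finally show ?thesis using False by simp
qed

lemma integral_cis_of_int:
  "integral {-pi..pi} (\<lambda>x. cis (of_int n * x)) = (if n = 0 then 2 * of_real pi else 0)"
proof -
  have "sin (of_int n * pi) = 0" by (simp add: sin_integer_2pi sin_zero_iff_int2)
  then show ?thesis
    using integral_unique[OF has_integral_cis_mult[of "of_int n"]] by simp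
qed

definition fourier_walks :: "nat \<Rightarrow> int \<Rightarrow> int \<Rightarrow> complex" where
  "fourier_walks k a b = 1 / (2 * complex_of_real pi) ^ 3 *
     torus_integral (\<lambda>x y z. complex_of_real (norm (cis x + cis y + cis z) ^ (2 * k)) *
        cis (of_int a * (x - z) + of_int b * (y - z)))"

lemma fourier_walks_0: "fourier_walks 0 a b = of_bool (a = 0 \<and> b = 0)"
proof -
  have "torus_integral (\<lambda>x y z. cis (of_int a * (x - z) + of_int b * (y - z))) =
    torus_integral (\<lambda>x y z. cis (of_int (- a - b) * z) * (cis (of_int b * y) * cis (of_int a * x)))"
    by (simp add: cis_mult algebra_simps)
  also have "\<dots> = (if - a - b = 0 then 2 * of_real pi else 0) *
      ((if b = 0 then 2 * of_real pi else 0) * (if a = 0 then 2 * of_real pi else 0))"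
    unfolding torus_integral_def
    by (simp only: integral_mult_right integral_mult_left integral_cis_of_int)
  finally show ?thesis
    by (simp add: fourier_walks_def power3_eq_cube)
qed

lemma fourier_walks_Suc:
  "fourier_walks (Suc k) a b =
     3 * fourier_walks k a b + (\<Sum>s\<in>tri_steps. fourier_walks k (a + fst s) (b + snd s))"
proof -
  let ?g = "\<lambda>a b x y z. complex_of_real (norm (cis x + cis y + cis z) ^ (2 * k)) *
        cis (of_int a * (x - z) + of_int b * (y - z))"
  have cont: "continuous_on UNIV (\<lambda>(x, y, z). ?g a b x y z)" for a b :: int
    by (auto simp: case_prod_unfold cis_conv_exp intro!: continuous_intros)
  have cont3: "continuous_on UNIV (\<lambda>(x, y, z). 3 * ?g a b x y z)"
    by (auto simp: case_prod_unfold cis_conv_exp intro!: continuous_intros)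
  have conts: "continuous_on UNIV (\<lambda>(x, y, z). \<Sum>s\<in>tri_steps. ?g (a + fst s) (b + snd s) x y z)"
    by (auto simp: case_prod_unfold cis_conv_exp intro!: continuous_intros)
  have fin: "finite tri_steps" by (simp add: tri_steps_def)
  let ?T = "\<lambda>a b. torus_integral (?g a b)"
  have "complex_of_real (norm (cis x + cis y + cis z) ^ (2 * Suc k)) *
        cis (of_int a * (x - z) + of_int b * (y - z)) =
      3 * ?g a b x y z + (\<Sum>s\<in>tri_steps. ?g (a + fst s) (b + snd s) x y z)" for x y z
  proof -
    have "norm (cis x + cis y + cis z) ^ (2 * Suc k) =
        norm (cis x + cis y + cis z) ^ (2 * k) * norm (cis x + cis y + cis z) ^ 2"
      by (simp add: power_add[symmetric])
    then show ?thesis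
      by (simp only: of_real_mult mult.assoc norm_sum_cis_power2 distrib_left sum_distrib_left
          of_int_add mult.left_commute[of _ 3])
  qed
  then have "torus_integral (\<lambda>x y z. complex_of_real (norm (cis x + cis y + cis z) ^ (2 * Suc k)) *
        cis (of_int a * (x - z) + of_int b * (y - z))) =
      torus_integral (\<lambda>x y z. 3 * ?g a b x y z + (\<Sum>s\<in>tri_steps. ?g (a + fst s) (b + snd s) x y z))"
    by (simp only:)
  also have "\<dots> = torus_integral (\<lambda>x y z. 3 * ?g a b x y z) +
      torus_integral (\<lambda>x y z. \<Sum>s\<in>tri_steps. ?g (a + fst s) (b + snd s) x y z)"
    by (rule torus_integral_add[OF cont3 conts])
  also have "torus_integral (\<lambda>x y z. 3 * ?g a b x y z) = 3 * ?T a b"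
    by (rule torus_integral_cmult)
  also have "torus_integral (\<lambda>x y z. \<Sum>s\<in>tri_steps. ?g (a + fst s) (b + snd s) x y z) =
      (\<Sum>s\<in>tri_steps. ?T (a + fst s) (b + snd s))"
    by (rule torus_integral_sum[OF fin cont])
  finally have eq: "torus_integral (\<lambda>x y z. complex_of_real (norm (cis x + cis y + cis z) ^ (2 * Suc k)) *
        cis (of_int a * (x - z) + of_int b * (y - z))) =
      3 * ?T a b + (\<Sum>s\<in>tri_steps. ?T (a + fst s) (b + snd s))" .
  have "c * (3 * t + (\<Sum>s\<in>tri_steps. u s)) = 3 * (c * t) + (\<Sum>s\<in>tri_steps. c * u s)"
    for c t :: complex and u
    by (simp add: distrib_left sum_distrib_left)
  then show ?thesis
    unfolding fourier_walks_def eq .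
qed

lemma fourier_walks_has_sum:
  assumes pq: "(p, q) \<in> nanotube_index"
  shows "((\<lambda>j. fourier_walks k (a + j * int p) (b + j * int q)) has_sum
     of_nat (tube_walks p q k (tube_vertex p q a b) (tube_vertex p q 0 0))) UNIV"
proof (induction k arbitrary: a b)
  case 0
  have p: "int p > 0" using pq by (auto simp: nanotube_index_def)
  show ?case
  proof (cases "tube_vertex p q a b = tube_vertex p q 0 0")
    case True
    then obtain i where i: "0 = a + i * int p" "0 = b + i * int q"
      unfolding tube_vertex_eq_iff by blast
    have "a + j * int p = 0 \<and> b + j * int q = 0 \<longleftrightarrow> j = i" for j
    proof
      assume "a + j * int p = 0 \<and> b + j * int q = 0"
      then have "j * int p = i * int p" using i by linarith
      then show "j = i" using p by simp
    next
      assume "j = i"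
      then show "a + j * int p = 0 \<and> b + j * int q = 0" using i by simp
    qed
    then have "fourier_walks 0 (a + j * int p) (b + j * int q) = of_bool (j = i)" for j
      by (simp only: fourier_walks_0)
    then show ?thesis
      using True by (intro has_sum_finite_neutralI[of "{i}"]) simp_all
  next
    case False
    have "fourier_walks 0 (a + j * int p) (b + j * int q) = 0" for j
    proof -
      have "\<not> (0 = a + j * int p \<and> 0 = b + j * int q)"
        using False unfolding tube_vertex_eq_iff by blast
      then have "\<not> (a + j * int p = 0 \<and> b + j * int q = 0)" by metis
      then show ?thesis by (simp only: fourier_walks_0 of_bool_eq)
    qed
    then show ?thesis using False by simp
  qed
next
  case (Suc k)
  have S: "((\<lambda>j. \<Sum>s\<in>S. fourier_walks k (a + fst s + j * int p) (b + snd s + j * int q)) has_sum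
      (\<Sum>s\<in>S. of_nat (tube_walks p q k (tube_vertex p q (a + fst s) (b + snd s)) (tube_vertex p q 0 0)))) UNIV"
    if "finite S" for S :: "(int \<times> int) set"
    using that
  proof (induction S rule: finite_induct)
    case empty
    show ?case by simp
  next
    case (insert s S)
    show ?case
      unfolding sum.insert[OF insert.hyps]
      by (rule has_sum_add[OF Suc insert.IH])
  qed
  have "finite tri_steps" by (simp add: tri_steps_def)
  note has_sum_add[OF has_sum_cmult_right[OF Suc[of a b], of 3] S[OF this]]
  moreover have "fourier_walks (Suc k) (a + j * int p) (b + j * int q) =
      3 * fourier_walks k (a + j * int p) (b + j * int q) +
      (\<Sum>s\<in>tri_steps. fourier_walks k (a + fst s + j * int p) (b + snd s + j * int q))" for j
    by (simp only: fourier_walks_Suc add.assoc add.commute[of "j * int p"] add.commute[of "j * int q"])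
  moreover have "of_nat (tube_walks p q (Suc k) (tube_vertex p q a b) (tube_vertex p q 0 0)) =
      3 * of_nat (tube_walks p q k (tube_vertex p q a b) (tube_vertex p q 0 0)) +
      (\<Sum>s\<in>tri_steps. (of_nat :: nat \<Rightarrow> complex)
        (tube_walks p q k (tube_vertex p q (a + fst s) (b + snd s)) (tube_vertex p q 0 0)))"
    unfolding tube_walks_Suc[OF pq] by (simp only: of_nat_add of_nat_mult of_nat_sum of_nat_numeral)
  ultimately show ?case by (simp only:)
qed

lemma dual_nanotube_moment_eq_fourier:
  "dual_nanotube_moment p q k = (\<Sum>\<^sub>\<infinity>j. fourier_walks k (j * int p) (j * int q))"
proof -
  have "exp (\<i> * of_int j * of_real (real p * (x - z) + real q * (y - z))) =
      cis (of_int (j * int p) * (x - z) + of_int (j * int q) * (y - z))" for j x y z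
  proof -
    have "of_int (j * int p) * (x - z) + of_int (j * int q) * (y - z) =
        of_int j * (real p * (x - z) + real q * (y - z))"
      by (simp add: distrib_left)
    then show ?thesis by (simp add: cis_conv_exp mult.assoc)
  qed
  then show ?thesis
    unfolding dual_nanotube_moment_def fourier_walks_def infsum_cmult_right'
    by (simp only: cis_conv_exp[symmetric])
qed

theorem dual_nanotube_moment_eq_walks:
  assumes "(p, q) \<in> nanotube_index"
  shows "dual_nanotube_moment p q k =
    of_nat (tube_walks p q k (tube_vertex p q 0 0) (tube_vertex p q 0 0))"
  using infsumI[OF fourier_walks_has_sum[OF assms, of k 0 0]]
  by (simp add: dual_nanotube_moment_eq_fourier)


subsection \<open>Existence of the random eigenvalue\<close>

text \<open>
  The eigenvalue is the squared modulus of \<open>exp(i X) + exp(i Y) + 1\<close>, where \<open>(X, Y)\<close> is Haar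
  distributed on the subgroup \<open>p X + q Y = 0\<close> of the torus: \<open>Y\<close> is uniform on a period and \<open>X\<close> is
  a uniformly chosen solution of that equation.
\<close>

definition circle_measure :: "real measure" where
  "circle_measure = uniform_measure lborel {-pi..pi}"

lemma circle_measure_density:
  "circle_measure = density lborel (\<lambda>x. ennreal (indicator {-pi..pi} x / (2 * pi)))"
  unfolding circle_measure_def uniform_measure_def
proof (rule density_cong)
  show "AE x in lborel. indicator {-pi..pi} x / emeasure lborel {-pi..pi} =
      ennreal (indicator {-pi..pi} x / (2 * pi))"
  proof (rule AE_I2)
    fix x :: real
    have "emeasure lborel {-pi..pi} = ennreal (2 * pi)" by simp
    then show "indicator {-pi..pi} x / emeasure lborel {-pi..pi} =
        ennreal (indicator {-pi..pi} x / (2 * pi))"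
      using divide_ennreal[of "indicator {-pi..pi} x" "2 * pi"] by (simp add: ennreal_indicator)
  qed
qed measurable

lemma integral_circle_measure_cis:
  "(\<integral>y. cis (d + c * y) \<partial>circle_measure) =
     cis d * of_real (if c = 0 then 1 else sin (c * pi) / (c * pi))"
proof -
  have cont: "continuous_on {-pi..pi} (\<lambda>y. cis (c * y))"
    by (auto simp: cis_conv_exp intro!: continuous_intros)
  have meas: "(\<lambda>y. cis (d + c * y)) \<in> borel_measurable lborel"
    by (auto simp: cis_conv_exp intro!: borel_measurable_continuous_onI continuous_intros)
  have "(\<integral>y. cis (d + c * y) \<partial>circle_measure) =
      (\<integral>y. (indicator {-pi..pi} y / (2 * pi)) *\<^sub>R cis (d + c * y) \<partial>lborel)"
    unfolding circle_measure_density by (rule integral_density[OF meas]) auto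
  also have "\<dots> = (\<integral>y. (cis d / of_real (2 * pi)) * (indicator {-pi..pi} y *\<^sub>R cis (c * y)) \<partial>lborel)"
    by (intro Bochner_Integration.integral_cong)
       (simp_all add: scaleR_conv_of_real cis_mult[symmetric])
  also have "\<dots> = (cis d / of_real (2 * pi)) * (LINT y : {-pi..pi} | lborel. cis (c * y))"
    unfolding set_lebesgue_integral_def by (rule integral_mult_right_zero)
  also have "(LINT y : {-pi..pi} | lborel. cis (c * y)) = integral {-pi..pi} (\<lambda>y. cis (c * y))"
    by (rule set_borel_integral_eq_integral(2)[OF borel_integrable_atLeastAtMost'[OF cont]])
  also have "\<dots> = (if c = 0 then 2 * of_real pi else of_real (2 * sin (c * pi) / c))"
    by (rule integral_unique[OF has_integral_cis_mult])
  finally have eq: "(\<integral>y. cis (d + c * y) \<partial>circle_measure) = cis d / of_real (2 * pi) *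
      (if c = 0 then 2 * of_real pi else of_real (2 * sin (c * pi) / c))" .
  show ?thesis unfolding eq by (cases "c = 0") (simp_all add: field_simps)
qed

lemma sum_cis_roots:
  assumes "p > 0"
  shows "(\<Sum>m<p. cis (2 * pi * of_int a * real m / real p)) = (if int p dvd a then of_nat p else 0)"
proof -
  define w where "w = cis (2 * pi * of_int a / real p)"
  have pow: "cis (2 * pi * of_int a * real m / real p) = w ^ m" for m
    unfolding w_def Complex.DeMoivre by (rule arg_cong[of _ _ cis]) (simp add: mult_ac)
  have "w ^ p = cis (2 * pi * of_int a)"
    using assms unfolding w_def Complex.DeMoivre by simp
  also have "\<dots> = 1" by (rule cis_multiple_2pi) simp
  finally have wp: "w ^ p = 1" .
  show ?thesis
  proof (cases "int p dvd a")
    case True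
    then obtain j where "a = int p * j" by blast
    then have "2 * pi * of_int a / real p = 2 * pi * of_int j" using assms by simp
    then have "w = cis (2 * pi * of_int j)" by (simp only: w_def)
    also have "\<dots> = 1" by (rule cis_multiple_2pi) simp
    finally show ?thesis using True unfolding pow by simp
  next
    case False
    have "w \<noteq> 1"
    proof
      assume "w = 1"
      then have "cos (2 * pi * of_int a / real p) = 1" by (simp add: w_def complex_eq_iff)
      then obtain j :: int where "2 * pi * of_int a / real p = of_int j * (2 * pi)"
        unfolding cos_one_2pi_int by (auto simp: mult_ac)
      then have "of_int a = of_int j * real p" using assms by (simp add: field_simps)
      then have "real_of_int a = real_of_int (j * int p)" by simp
      then have "a = j * int p" by (simp only: of_int_eq_iff)
      then show False using False by simp
    qed
    then show ?thesis using False wp unfolding pow by (simp add: geometric_sum)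
  qed
qed

definition tube_space :: "nat \<Rightarrow> (nat \<times> real) measure" where
  "tube_space p = measure_pmf (pmf_of_set {..<p}) \<Otimes>\<^sub>M circle_measure"

definition tube_phase :: "nat \<Rightarrow> nat \<Rightarrow> nat \<times> real \<Rightarrow> real" where
  "tube_phase p q \<omega> = (2 * pi * real (fst \<omega>) - real q * snd \<omega>) / real p"

definition tube_eigenvalue :: "nat \<Rightarrow> nat \<Rightarrow> nat \<times> real \<Rightarrow> real" where
  "tube_eigenvalue p q \<omega> = norm (cis (tube_phase p q \<omega>) + cis (snd \<omega>) + cis 0) ^ 2"

lemma prob_space_circle_measure: "prob_space circle_measure"
  unfolding circle_measure_def by (rule prob_space_uniform_measure) simp_all

lemma prob_space_tube_space: "prob_space (tube_space p)"
proof -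
  interpret C: prob_space circle_measure by (rule prob_space_circle_measure)
  interpret P: pair_prob_space "measure_pmf (pmf_of_set {..<p})" circle_measure ..
  show ?thesis unfolding tube_space_def by (rule P.prob_space_axioms)
qed

lemma tube_phase_measurable: "tube_phase p q \<in> borel_measurable (tube_space p)"
  and snd_tube_space_measurable: "snd \<in> borel_measurable (tube_space p)"
proof -
  have "fst \<in> measurable (tube_space p) (measure_pmf (pmf_of_set {..<p}))"
    unfolding tube_space_def by (rule measurable_fst)
  then have "fst \<in> measurable (tube_space p) (count_space UNIV)"
    by (simp cong: measurable_cong_sets)
  from measurable_compose[OF this, of real borel]
  have [measurable]: "(\<lambda>\<omega>. real (fst \<omega>)) \<in> borel_measurable (tube_space p)" by simp
  show snd [measurable]: "snd \<in> borel_measurable (tube_space p)"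
  proof -
    have "snd \<in> measurable (tube_space p) circle_measure"
      unfolding tube_space_def by (rule measurable_snd)
    moreover have "sets circle_measure = sets borel" by (simp add: circle_measure_def)
    ultimately show ?thesis by (simp cong: measurable_cong_sets)
  qed
  show "tube_phase p q \<in> borel_measurable (tube_space p)"
    unfolding tube_phase_def by measurable
qed

lemma cis_borel_measurable: "cis \<in> borel_measurable borel"
  unfolding cis_conv_exp by (intro borel_measurable_continuous_onI continuous_intros)

lemma tube_eigenvalue_measurable: "tube_eigenvalue p q \<in> borel_measurable (tube_space p)"
proof -
  note [measurable] = tube_phase_measurable snd_tube_space_measurable
    measurable_compose[OF tube_phase_measurable cis_borel_measurable]
    measurable_compose[OF snd_tube_space_measurable cis_borel_measurable]
  show ?thesis unfolding tube_eigenvalue_def by measurable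
qed

lemma tube_eigenvalue_bounds: "0 \<le> tube_eigenvalue p q \<omega>" "tube_eigenvalue p q \<omega> \<le> 9"
proof -
  have "norm (cis (tube_phase p q \<omega>) + cis (snd \<omega>) + cis 0) \<le> 1 + 1 + 1"
    by (intro order.trans[OF norm_triangle_ineq] add_mono) simp_all
  from power_mono[OF this, of 2] show "tube_eigenvalue p q \<omega> \<le> 9"
    unfolding tube_eigenvalue_def by simp
qed (simp add: tube_eigenvalue_def)

definition tube_mixed :: "nat \<Rightarrow> nat \<Rightarrow> nat \<Rightarrow> real \<Rightarrow> real \<Rightarrow> nat \<times> real \<Rightarrow> complex" where
  "tube_mixed p q k a b \<omega> =
     complex_of_real (tube_eigenvalue p q \<omega> ^ k) * cis (a * tube_phase p q \<omega> + b * snd \<omega>)"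

lemma tube_mixed_integrable: "integrable (tube_space p) (tube_mixed p q k a b)"
proof -
  interpret T: prob_space "tube_space p" by (rule prob_space_tube_space)
  note [measurable] = tube_phase_measurable[of p q] snd_tube_space_measurable[of p]
    tube_eigenvalue_measurable[of p q]
  have "(\<lambda>\<omega>. a * tube_phase p q \<omega> + b * snd \<omega>) \<in> borel_measurable (tube_space p)"
    by measurable
  note [measurable] = measurable_compose[OF this cis_borel_measurable]
  show ?thesis
  proof (rule T.integrable_const_bound[where B = "9 ^ k"])
    show "tube_mixed p q k a b \<in> borel_measurable (tube_space p)"
      unfolding tube_mixed_def by measurable
    show "AE \<omega> in tube_space p. norm (tube_mixed p q k a b \<omega>) \<le> 9 ^ k"
    proof (rule AE_I2)
      fix \<omega>
      have "norm (tube_mixed p q k a b \<omega>) = tube_eigenvalue p q \<omega> ^ k"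
        using tube_eigenvalue_bounds(1)[of p q \<omega>] by (simp add: tube_mixed_def norm_mult norm_power)
      also have "\<dots> \<le> 9 ^ k" by (intro power_mono tube_eigenvalue_bounds)
      finally show "norm (tube_mixed p q k a b \<omega>) \<le> 9 ^ k" .
    qed
  qed
qed

lemma integral_tube_mixed_0:
  assumes p: "p > 0"
  shows "(\<integral>\<omega>. tube_mixed p q 0 (of_int a) (of_int b) \<omega> \<partial>tube_space p) =
    of_bool (tube_vertex p q a b = tube_vertex p q 0 0)"
proof -
  interpret C: prob_space circle_measure by (rule prob_space_circle_measure)
  interpret P: pair_prob_space "measure_pmf (pmf_of_set {..<p})" circle_measure ..
  define c where "c = of_int b - of_int a * real q / real p"
  let ?K = "complex_of_real (if c = 0 then 1 else sin (c * pi) / (c * pi))"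
  have "(\<integral>\<omega>. tube_mixed p q 0 (of_int a) (of_int b) \<omega> \<partial>tube_space p) =
      (\<integral>m. (\<integral>y. tube_mixed p q 0 (of_int a) (of_int b) (m, y) \<partial>circle_measure)
        \<partial>measure_pmf (pmf_of_set {..<p}))"
    unfolding tube_space_def
    by (rule P.integral_fst'[symmetric]) (rule tube_mixed_integrable[unfolded tube_space_def])
  also have "(\<lambda>m y. tube_mixed p q 0 (of_int a) (of_int b) (m, y)) =
      (\<lambda>m y. cis (2 * pi * of_int a * real m / real p + c * y))"
    using p by (intro ext) (simp add: tube_mixed_def tube_phase_def c_def field_simps)
  also have "(\<integral>m. (\<integral>y. cis (2 * pi * of_int a * real m / real p + c * y) \<partial>circle_measure)
        \<partial>measure_pmf (pmf_of_set {..<p})) =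
      (\<integral>m. cis (2 * pi * of_int a * real m / real p) * ?K \<partial>measure_pmf (pmf_of_set {..<p}))"
    by (simp only: integral_circle_measure_cis)
  also have "\<dots> = (\<Sum>m<p. pmf (pmf_of_set {..<p}) m *\<^sub>R
      (cis (2 * pi * of_int a * real m / real p) * ?K))"
    using p by (intro integral_measure_pmf) (auto simp: lessThan_empty_iff)
  also have "\<dots> = (\<Sum>m<p. (?K / of_nat p) * cis (2 * pi * of_int a * real m / real p))"
    using p by (intro sum.cong) (auto simp: lessThan_empty_iff scaleR_conv_of_real)
  also have "\<dots> = (?K / of_nat p) * (if int p dvd a then of_nat p else 0)"
    unfolding sum_distrib_left[symmetric] sum_cis_roots[OF p] ..
  also have "\<dots> = (if int p dvd a then ?K else 0)" using p by simp
  also have "\<dots> = of_bool (tube_vertex p q a b = tube_vertex p q 0 0)"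
  proof (cases "int p dvd a")
    case True
    then obtain j where j: "a = int p * j" by blast
    then have c: "c = of_int (b - j * int q)" using p by (simp add: c_def)
    have "sin (c * pi) = 0" unfolding c sin_zero_iff_int2 by blast
    then have K: "?K = of_bool (c = 0)" by simp
    have "c = 0 \<longleftrightarrow> b = j * int q" unfolding c by (simp only: of_int_eq_0_iff right_minus_eq)
    also have "\<dots> \<longleftrightarrow> tube_vertex p q a b = tube_vertex p q 0 0"
    proof
      assume "b = j * int q"
      then show "tube_vertex p q a b = tube_vertex p q 0 0"
        using tube_vertex_shift[of p q 0 j 0] j by (simp add: mult.commute)
    next
      assume "tube_vertex p q a b = tube_vertex p q 0 0"
      then obtain i where i: "0 = a + i * int p" "0 = b + i * int q"
        unfolding tube_vertex_eq_iff by blast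
      have "(j + i) * int p = 0" using i(1) j by (simp add: algebra_simps)
      then have "i = - j" using p by simp
      then show "b = j * int q" using i(2) by simp
    qed
    finally show ?thesis using True K by simp
  next
    case False
    have "tube_vertex p q a b \<noteq> tube_vertex p q 0 0"
    proof
      assume "tube_vertex p q a b = tube_vertex p q 0 0"
      then obtain i where "0 = a + i * int p" unfolding tube_vertex_eq_iff by blast
      then have "a = (- i) * int p" by simp
      then show False using False by simp
    qed
    then show ?thesis using False by simp
  qed
  finally show ?thesis .
qed

lemma integral_tube_mixed:
  assumes pq: "(p, q) \<in> nanotube_index"
  shows "(\<integral>\<omega>. tube_mixed p q k (of_int a) (of_int b) \<omega> \<partial>tube_space p) =
    of_nat (tube_walks p q k (tube_vertex p q a b) (tube_vertex p q 0 0))"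
proof (induction k arbitrary: a b)
  case 0
  have "p > 0" using pq by (auto simp: nanotube_index_def)
  then show ?case by (simp only: integral_tube_mixed_0 tube_walks.simps of_nat_of_bool)
next
  case (Suc k)
  let ?X = "tube_mixed p q k"
  have "tube_mixed p q (Suc k) (of_int a) (of_int b) \<omega> =
      3 * ?X (of_int a) (of_int b) \<omega> +
      (\<Sum>s\<in>tri_steps. ?X (of_int (a + fst s)) (of_int (b + snd s)) \<omega>)" for \<omega>
  proof -
    have "tube_mixed p q (Suc k) (of_int a) (of_int b) \<omega> =
        complex_of_real (tube_eigenvalue p q \<omega> ^ k) *
        (complex_of_real (norm (cis (tube_phase p q \<omega>) + cis (snd \<omega>) + cis 0) ^ 2) *
        cis (of_int a * (tube_phase p q \<omega> - 0) + of_int b * (snd \<omega> - 0)))"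
      by (simp add: tube_mixed_def tube_eigenvalue_def)
    then show ?thesis
      unfolding norm_sum_cis_power2
      by (simp only: tube_mixed_def distrib_left sum_distrib_left of_int_add diff_0_right
          mult.left_commute[of _ 3])
  qed
  then have "(\<integral>\<omega>. tube_mixed p q (Suc k) (of_int a) (of_int b) \<omega> \<partial>tube_space p) =
      (\<integral>\<omega>. 3 * ?X (of_int a) (of_int b) \<omega> +
        (\<Sum>s\<in>tri_steps. ?X (of_int (a + fst s)) (of_int (b + snd s)) \<omega>) \<partial>tube_space p)"
    by (simp only:)
  also have "\<dots> = (\<integral>\<omega>. 3 * ?X (of_int a) (of_int b) \<omega> \<partial>tube_space p) +
      (\<integral>\<omega>. (\<Sum>s\<in>tri_steps. ?X (of_int (a + fst s)) (of_int (b + snd s)) \<omega>) \<partial>tube_space p)"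
    by (intro Bochner_Integration.integral_add integrable_mult_right
        Bochner_Integration.integrable_sum tube_mixed_integrable)
  also have "(\<integral>\<omega>. 3 * ?X (of_int a) (of_int b) \<omega> \<partial>tube_space p) =
      3 * (\<integral>\<omega>. ?X (of_int a) (of_int b) \<omega> \<partial>tube_space p)"
    by (rule integral_mult_right_zero)
  also have "(\<integral>\<omega>. (\<Sum>s\<in>tri_steps. ?X (of_int (a + fst s)) (of_int (b + snd s)) \<omega>) \<partial>tube_space p) =
      (\<Sum>s\<in>tri_steps. \<integral>\<omega>. ?X (of_int (a + fst s)) (of_int (b + snd s)) \<omega> \<partial>tube_space p)"
    by (intro Bochner_Integration.integral_sum tube_mixed_integrable)
  finally show ?case
    unfolding Suc tube_walks_Suc[OF pq]
    by (simp only: of_nat_add of_nat_mult of_nat_sum of_nat_numeral)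
qed

theorem dual_nanotube_eigenvalue_exists:
  assumes "(p, q) \<in> nanotube_index"
  shows "dual_nanotube_eigenvalue p q (tube_space p) (tube_eigenvalue p q)"
  unfolding dual_nanotube_eigenvalue_def
proof (intro conjI allI exI[of _ "{0..9}"])
  fix k
  have "complex_of_real (\<integral>\<omega>. tube_eigenvalue p q \<omega> ^ k \<partial>tube_space p) =
      (\<integral>\<omega>. tube_mixed p q k (of_int 0) (of_int 0) \<omega> \<partial>tube_space p)"
    unfolding tube_mixed_def by (simp flip: integral_complex_of_real)
  then show "complex_of_real (\<integral>\<omega>. tube_eigenvalue p q \<omega> ^ k \<partial>tube_space p) =
      dual_nanotube_moment p q k"
    by (simp only: integral_tube_mixed[OF assms] dual_nanotube_moment_eq_walks[OF assms])
qed (auto simp: prob_space_tube_space tube_eigenvalue_measurable tube_eigenvalue_bounds)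

end

theory Submission
  imports Defs
begin

text \<open>
  The squared modulus of \<open>exp(i x) + exp(i y) + 1\<close> is \<open>3\<close> plus the sum of the characters of the six
  lattice steps. Expanding its \<open>k\<close>-th power multinomially and integrating over the subgroup
  \<open>p x + q y = 0\<close> of the torus keeps the terms whose total displacement lies in the
  subgroup generated by \<open>(p, q)\<close>; the indicator in the theorem expresses this.
\<close>

text \<open>Division by the factorial turns the binomial theorem into a convolution free of binomial
  coefficients, so that repeated expansion leaves a plain product of reciprocal factorials.\<close>

lemma power_add_div_fact:
  fixes x y :: "'a::field_char_0"
  shows "(x + y) ^ n / fact n = (\<Sum>i\<le>n. (x ^ i / fact i) * (y ^ (n - i) / fact (n - i)))"
  unfolding binomial_ring sum_divide_distrib
  by (intro sum.cong refl) (simp add: binomial_fact)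

lemma fibre_cons_eq:
  fixes g :: "'b \<Rightarrow> nat"
  shows "{s. (case s of (i, t) \<Rightarrow> i + g t) = n} = (SIGMA i:{..n}. {t. g t = n - i})"
  by auto

lemma finite_fibre_cons:
  fixes g :: "'b \<Rightarrow> nat"
  assumes "\<And>m. finite {t. g t = m}"
  shows "finite {s. (case s of (i, t) \<Rightarrow> i + g t) = n}"
  unfolding fibre_cons_eq using assms by (intro finite_SigmaI) auto

text \<open>
  The index set is not written \<open>{(i, t). i + g t = n}\<close>, so that the conclusion has the shape
  of the premise \<open>y\<close> and the lemma can be iterated.
\<close>

lemma multinomial_cons:
  fixes x y :: "'a::field_char_0" and g :: "'b \<Rightarrow> nat"
  assumes fin: "\<And>m. finite {t. g t = m}"
    and y: "\<And>m. y ^ m / fact m = (\<Sum>t | g t = m. h t)"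
  shows "(x + y) ^ n / fact n =
    (\<Sum>s | (case s of (i, t) \<Rightarrow> i + g t) = n. case s of (i, t) \<Rightarrow> x ^ i / fact i * h t)"
  unfolding fibre_cons_eq power_add_div_fact y sum_distrib_left
  using fin by (subst sum.Sigma) auto

text \<open>Six uses of \<open>multinomial_cons\<close> prepend \<open>x6\<close> down to
  \<open>x1\<close> to the one-term sum \<open>x7\<close>; the nested pairs that arise are exactly
  the 7-tuples.\<close>

lemma multinomial7:
  fixes x1 :: "'a::field_char_0"
  shows "(x1 + x2 + x3 + x4 + x5 + x6 + x7) ^ k =
    (\<Sum>(k1, k2, k3, k4, k5, k6, k7) \<in>
        {(k1, k2, k3, k4, k5, k6, k7). k1 + k2 + k3 + k4 + k5 + k6 + k7 = k}.
      fact k / (fact k1 * fact k2 * fact k3 * fact k4 * fact k5 * fact k6 * fact k7) *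
      (x1 ^ k1 * x2 ^ k2 * x3 ^ k3 * x4 ^ k4 * x5 ^ k5 * x6 ^ k6 * x7 ^ k7))"
proof -
  have f1: "finite {t. t = (m :: nat)}" for m by simp
  have y1: "x7 ^ m / fact m = (\<Sum>t | t = m. x7 ^ t / fact t)" for m by simp
  note f2 = finite_fibre_cons[OF f1] and y2 = multinomial_cons[OF f1 y1, of x6]
  note f3 = finite_fibre_cons[OF f2] and y3 = multinomial_cons[OF f2 y2, of x5]
  note f4 = finite_fibre_cons[OF f3] and y4 = multinomial_cons[OF f3 y3, of x4]
  note f5 = finite_fibre_cons[OF f4] and y5 = multinomial_cons[OF f4 y4, of x3]
  note f6 = finite_fibre_cons[OF f5] and y6 = multinomial_cons[OF f5 y5, of x2]
  note y7 = multinomial_cons[OF f6 y6, of x1 k]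
  have "(x1 + x2 + x3 + x4 + x5 + x6 + x7) ^ k =
      fact k * ((x1 + (x2 + (x3 + (x4 + (x5 + (x6 + x7)))))) ^ k / fact k)"
    by (simp add: add.assoc)
  then show ?thesis
    unfolding y7 by (simp add: case_prod_unfold add.assoc sum_distrib_left mult_ac)
qed

text \<open>As \<open>p > 0\<close>, the first coordinate fixes the only candidate multiple of
  \<open>(p, q)\<close>; the cross-multiplied equation then tests the second coordinate without
  division.\<close>

lemma tube_vertex_eq_origin_iff:
  assumes "p > 0"
  shows "tube_vertex p q a b = tube_vertex p q 0 0 \<longleftrightarrow> int p dvd a \<and> int p * b = int q * a"
proof
  assume "tube_vertex p q a b = tube_vertex p q 0 0"
  then obtain j where "0 = a + j * int p" "0 = b + j * int q"
    unfolding tube_vertex_eq_iff by blast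
  then have "a = int p * (- j)" "b = int q * (- j)" by (simp_all add: algebra_simps)
  then show "int p dvd a \<and> int p * b = int q * a" by simp
next
  assume *: "int p dvd a \<and> int p * b = int q * a"
  then obtain j where j: "a = int p * j" by blast
  with * assms have "b = int q * j" by simp
  with j show "tube_vertex p q a b = tube_vertex p q 0 0"
    unfolding tube_vertex_eq_iff by (intro exI[of _ "- j"]) simp
qed

text \<open>The case \<open>z = 0\<close> with trivial extra character of
  \<open>norm_sum_cis_power2\<close>. The summands are ordered so that their exponents become
  \<open>k1\<close> to \<open>k7\<close>.\<close>

lemma tube_eigenvalue_characters:
  "complex_of_real (tube_eigenvalue p q \<omega>) =
    (let x = tube_phase p q \<omega>; y = snd \<omega> in
      3 + cis (x - y) + cis y + cis x + cis (y - x) + cis (- y) + cis (- x))"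
  using norm_sum_cis_power2[of "tube_phase p q \<omega>" "snd \<omega>" 0 0 0]
  by (simp add: tube_eigenvalue_def tri_steps_def Let_def)

lemma integral_tube_eigenvalue_power:
  assumes "p > 0"
  shows "(\<integral>\<omega>. tube_mixed p q k 0 0 \<omega> \<partial>tube_space p) =
    (\<Sum>(k1, k2, k3, k4, k5, k6, k7) \<in>
        {(k1, k2, k3, k4, k5, k6, k7). k1 + k2 + k3 + k4 + k5 + k6 + k7 = k}.
      fact k / (fact k1 * fact k2 * fact k3 * fact k4 * fact k5 * fact k6 * fact k7) * 3 ^ k1 *
      of_bool (tube_vertex p q (int k2 + int k4 - int k5 - int k7)
        (- int k2 + int k3 + int k5 - int k6) = tube_vertex p q 0 0))"
proof -
  let ?S = "{(k1, k2, k3, k4, k5, k6, k7). k1 + k2 + k3 + k4 + k5 + k6 + k7 = k}"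
  let ?c = "\<lambda>(k1, k2, k3, k4, k5, k6, k7). fact k /
    (fact k1 * fact k2 * fact k3 * fact k4 * fact k5 * fact k6 * fact k7) * 3 ^ k1 :: complex"
  \<comment> \<open>\<open>(?a t, ?b t)\<close> is the total displacement: \<open>k2\<close>,
    \<open>k3\<close>, \<open>k4\<close> count the steps \<open>(1, -1)\<close>,
    \<open>(0, 1)\<close>, \<open>(1, 0)\<close>, and \<open>k5\<close>, \<open>k6\<close>,
    \<open>k7\<close> their opposites.\<close>
  let ?a = "\<lambda>(k1 :: nat, k2, k3 :: nat, k4, k5, k6 :: nat, k7). int k2 + int k4 - int k5 - int k7"
  let ?b = "\<lambda>(k1 :: nat, k2, k3, k4 :: nat, k5, k6, k7 :: nat). - int k2 + int k3 + int k5 - int k6"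
  have "tube_mixed p q k 0 0 \<omega> =
      (\<Sum>t\<in>?S. ?c t * tube_mixed p q 0 (of_int (?a t)) (of_int (?b t)) \<omega>)" for \<omega>
  proof -
    have "tube_mixed p q k 0 0 \<omega> = complex_of_real (tube_eigenvalue p q \<omega>) ^ k"
      by (simp add: tube_mixed_def)
    also have "\<dots> = (\<Sum>t\<in>?S. ?c t * tube_mixed p q 0 (of_int (?a t)) (of_int (?b t)) \<omega>)"
      unfolding tube_eigenvalue_characters Let_def multinomial7
      by (intro sum.cong refl)
         (clarsimp simp: tube_mixed_def Complex.DeMoivre cis_mult algebra_simps)
    finally show ?thesis .
  qed
  then have "(\<integral>\<omega>. tube_mixed p q k 0 0 \<omega> \<partial>tube_space p) =
      (\<integral>\<omega>. (\<Sum>t\<in>?S. ?c t * tube_mixed p q 0 (of_int (?a t)) (of_int (?b t)) \<omega>) \<partial>tube_space p)"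
    by (simp only:)
  also have "\<dots> = (\<Sum>t\<in>?S. ?c t *
      (\<integral>\<omega>. tube_mixed p q 0 (of_int (?a t)) (of_int (?b t)) \<omega> \<partial>tube_space p))"
    by (subst Bochner_Integration.integral_sum)
       (simp_all only: integral_mult_right_zero integrable_mult_right tube_mixed_integrable)
  \<comment> \<open>Orthogonality: a character integrates to 1 if it is trivial on the subgroup
    \<open>p x + q y = 0\<close>, and to 0 otherwise.\<close>
  also have "\<dots> = (\<Sum>t\<in>?S. ?c t * of_bool (tube_vertex p q (?a t) (?b t) = tube_vertex p q 0 0))"
    by (simp only: integral_tube_mixed_0[OF assms])
  also have "\<dots> = (\<Sum>(k1, k2, k3, k4, k5, k6, k7) \<in> ?S.
      fact k / (fact k1 * fact k2 * fact k3 * fact k4 * fact k5 * fact k6 * fact k7) * 3 ^ k1 *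
      of_bool (tube_vertex p q (int k2 + int k4 - int k5 - int k7)
        (- int k2 + int k3 + int k5 - int k6) = tube_vertex p q 0 0))"
    by (intro sum.cong refl) (clarsimp split: prod.splits)
  finally show ?thesis .
qed

theorem proposition7:
  fixes p q k :: nat and M :: "'a measure" and \<Lambda> :: "'a \<Rightarrow> real"
  assumes "(p, q) \<in> nanotube_index"
    and "dual_nanotube_eigenvalue p q M \<Lambda>"
  shows "(\<integral>\<omega>. \<Lambda> \<omega> ^ k \<partial>M) =
    (\<Sum>(k1, k2, k3, k4, k5, k6, k7) \<in>
        {(k1, k2, k3, k4, k5, k6, k7). k1 + k2 + k3 + k4 + k5 + k6 + k7 = k}.
      fact k / (fact k1 * fact k2 * fact k3 * fact k4 * fact k5 * fact k6 * fact k7) * 3 ^ k1 *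
      of_bool
       ([int p * int k - int k2 - int k4 + int k5 + int k7 = 0] (mod int p) \<and>
        int p * (- int k2 + int k3 + int k5 - int k6) =
          int q * (int k2 + int k4 - int k5 - int k7)))"
proof -
  have p: "p > 0" using assms(1) by (auto simp: nanotube_index_def)
  have cond: "tube_vertex p q (int k2 + int k4 - int k5 - int k7)
        (- int k2 + int k3 + int k5 - int k6) = tube_vertex p q 0 0 \<longleftrightarrow>
      [int p * int k - int k2 - int k4 + int k5 + int k7 = 0] (mod int p) \<and>
      int p * (- int k2 + int k3 + int k5 - int k6) = int q * (int k2 + int k4 - int k5 - int k7)"
    for k2 k3 k4 k5 k6 k7
  proof -
    \<comment> \<open>The term \<open>int p * int k\<close> vanishes modulo \<open>p\<close>, so the
      congruence only says that \<open>p\<close> divides the first coordinate of the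
      displacement.\<close>
    have "int p * int k - int k2 - int k4 + int k5 + int k7 =
        int p * int k - (int k2 + int k4 - int k5 - int k7)" by simp
    then show ?thesis
      unfolding tube_vertex_eq_origin_iff[OF p] cong_0_iff by (simp only: dvd_diff_right_iff dvd_triv_left)
  qed
  have "complex_of_real (\<integral>\<omega>. \<Lambda> \<omega> ^ k \<partial>M) = dual_nanotube_moment p q k"
    using assms(2) by (simp add: dual_nanotube_eigenvalue_def)
  \<comment> \<open>The moments of \<open>\<Lambda>\<close> and of the model
    \<open>tube_eigenvalue\<close> count the same closed walks, which moves the computation to
    \<open>tube_space\<close>.\<close>
  also have "\<dots> = (\<integral>\<omega>. tube_mixed p q k 0 0 \<omega> \<partial>tube_space p)"
    using integral_tube_mixed[OF assms(1), of k 0 0]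
    by (simp add: dual_nanotube_moment_eq_walks[OF assms(1)])
  also note integral_tube_eigenvalue_power[OF p]
  \<comment> \<open>The chain is complex-valued; injectivity of \<open>of_real\<close> returns to
    the reals.\<close>
  finally show ?thesis
    unfolding cond
    by (subst of_real_eq_iff[symmetric, where 'a = complex], unfold of_real_sum)
       (auto simp: of_bool_def intro!: sum.cong)
qed

end
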